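(* For any $r\in(0,1)$, let $$v_m=\max\Big\{\Big\lfloor\frac m2+\frac{\sqrt m}{2}Q^{-1}(1-r)\Big\rfloor,0\Big\}.$$ Then the rate $r_m$ of $\mathrm{RM}(v_m,m)$ satisfies $r_m\to r$ as $m\to\infty$, and the sequence $\{\mathrm{RM}(v_m,m)\}_m$ is capacity achieving on the BEC under bit-MAP decoding.
   Context: $Q(t)=\frac1{\sqrt{2\pi}}\int_t^\infty e^{-\tau^2/2}d\tau$. $\mathrm{RM}(v,m)$ is the binary code of length $N=2^m$ consisting of the evaluation vectors $(f(\underline{x}))_{\underline{x}\in\{0,1\}^m}$ of all polynomials $f$ over $\mathbb{F}_2$ in the span of multilinear monomials in $x_1,\dots,x_m$ of degree at most $v$; its rate is $2^{-m}\sum_{k=0}^v\binom mk$. A uniform codeword $\underline{X}$ is sent over $\mathrm{BEC}(p)$ (each bit erased independently with probability $p$), giving $\underline{Y}$; $P_b(p)=\frac1N\sum_i\Pr(X_i\text{ not uniquely determined by }\underline{Y})$. A code sequence with rates $r_n\to r\in(0,1)$ is capacity achieving under bit-MAP decoding if $P_b^{(n)}(p)\to0$ for every $p\in[0,1-r)$. *)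

theory Defs
  imports "HOL-Analysis.Analysis"
begin

text \<open>Gaussian tail function Q and its inverse (Q is a strictly decreasing bijection onto (0,1)).\<close>
definition Qfun :: "real \<Rightarrow> real" where
  "Qfun t = integral {t..} (\<lambda>\<tau>. exp (-(\<tau>^2) / 2)) / sqrt (2 * pi)"

definition Qinv :: "real \<Rightarrow> real" where
  "Qinv y = (THE t. Qfun t = y)"

text \<open>Points of {0,1}^m are encoded by their supports x \<subseteq> {..<m}.
  The multilinear monomial x_T (T \<subseteq> {..<m}) evaluates to 1 at x iff T \<subseteq> x.
  A polynomial over F_2 in the span of monomials of degree \<le> v is a sum of a set A of
  such monomials; its value at x is the parity of the number of monomials in A equal to 1.
  A codeword is a function on coordinates (points), taking False outside Pow {..<m}.\<close>
definition RM_monomials :: "nat \<Rightarrow> nat \<Rightarrow> nat set set" where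
  "RM_monomials v m = {T. T \<subseteq> {..<m} \<and> card T \<le> v}"

definition RM_coords :: "nat \<Rightarrow> nat set set" where
  "RM_coords m = Pow {..<m}"

definition RM_code :: "nat \<Rightarrow> nat \<Rightarrow> (nat set \<Rightarrow> bool) set" where
  "RM_code v m = {(\<lambda>x. x \<subseteq> {..<m} \<and> odd (card {T\<in>A. T \<subseteq> x})) | A. A \<subseteq> RM_monomials v m}"

definition RM_rate :: "nat \<Rightarrow> nat \<Rightarrow> real" where
  "RM_rate v m = (\<Sum>k=0..v. real (m choose k)) / 2 ^ m"

text \<open>Bit error probability of bit-MAP decoding of a uniformly chosen codeword of code C
  (coordinate set I) over BEC(p). E is the set of erased positions; bit i of X is not
  uniquely determined by Y iff some codeword agreeing with X on all unerased positions
  differs from X at position i.\<close>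
definition bit_MAP_Pb :: "'i set \<Rightarrow> ('i \<Rightarrow> bool) set \<Rightarrow> real \<Rightarrow> real" where
  "bit_MAP_Pb I C p =
     (1 / real (card I)) * (\<Sum>i\<in>I. \<Sum>E\<in>Pow I.
        p ^ card E * (1 - p) ^ (card I - card E) *
        ((1 / real (card C)) *
          real (card {X\<in>C. \<exists>c\<in>C. (\<forall>j\<in>I - E. c j = X j) \<and> c i \<noteq> X i})))"

definition capacity_achieving_BEC ::
    "(nat \<Rightarrow> real) \<Rightarrow> (nat \<Rightarrow> real \<Rightarrow> real) \<Rightarrow> real \<Rightarrow> bool" where
  "capacity_achieving_BEC rate Pb r \<longleftrightarrow>
     rate \<longlonglongrightarrow> r \<and> (\<forall>p. 0 \<le> p \<and> p < 1 - r \<longrightarrow> (\<lambda>n. Pb n p) \<longlonglongrightarrow> 0)"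

end

theory Submission
  imports Defs "HOL-Probability.Probability" "HOL-Real_Asymp.Real_Asymp"
begin

text \<open>
  The EXIT function \<open>h_m\<close> of \<open>RM(v,m)\<close> is the probability that a given bit is not determined by
  the unerased bits at the other positions. It bounds \<open>P_b\<close>, and by the area theorem
  \<open>\<integral> h_m\<close> is the rate \<open>r_m\<close>. As \<open>h_m\<close> is nondecreasing,
  \<open>h_m(p) (1 - p - r_m) \<le> \<integral> h_m (1 - h_m)\<close>, so it suffices that \<open>\<integral> h_m (1 - h_m) \<rightarrow> 0\<close>.

  Conditioning on the erasures in a subcube \<open>S\<close> of codimension \<open>j\<close> splits the variance
  \<open>h_m (1 - h_m)\<close> into two terms. Resampling the erasures outside \<open>S\<close> costs at most
  \<open>h_{m-j} - h_m\<close>, since \<open>RM(v,m)\<close> restricts to \<open>RM(v,m-j)\<close> on \<open>S\<close>; the integral of this is a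
  difference of rates, which is \<open>O(j / \<surd>m)\<close>. Resampling those in \<open>S\<close> costs, by the Efron--Stein
  inequality, at most the sum of the influences of the points of \<open>S\<close>. By double transitivity all
  influences are equal, so by the Margulis--Russo formula this sum is at most \<open>2^{-j} h_m'\<close>, whose
  integral is at most \<open>2^{-j}\<close>. It remains to let \<open>j \<rightarrow> \<infinity>\<close> with \<open>j = o(\<surd>m)\<close>.
\<close>

section \<open>Preliminaries\<close>

lemma odd_card_sym_diff:
  assumes "finite A" "finite B"
  shows "odd (card (sym_diff A B)) \<longleftrightarrow> odd (card A) \<noteq> odd (card B)"
proof -
  have "card A = card (A - B) + card (A \<inter> B)" "card B = card (B - A) + card (A \<inter> B)"
    using assms by (metis Int_commute add.commute card_Diff_subset_Int card_Int_Diff)+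
  moreover have "card (sym_diff A B) = card (A - B) + card (B - A)"
    using assms by (intro card_Un_disjoint) auto
  ultimately show ?thesis by auto
qed

lemma sum_subset_le_card_ratio:
  fixes t :: "'a \<Rightarrow> real"
  assumes "finite I" "S \<subseteq> I" "i \<in> S" and t: "t i = 0" "\<And>j. j \<in> I - {i} \<Longrightarrow> t j = a" and "0 \<le> a"
  shows "(\<Sum>j\<in>S. t j) \<le> real (card S) / real (card I) * (\<Sum>j\<in>I. t j)"
proof -
  have sum_eq: "(\<Sum>j\<in>A. t j) = (real (card A) - 1) * a" if "A \<subseteq> I" "i \<in> A" for A
  proof -
    have "finite A" using that(1) assms(1) by (rule finite_subset)
    then have "(\<Sum>j\<in>A. t j) = (\<Sum>j\<in>A - {i}. a)"
      using that t by (simp add: sum.remove[of A i t] subset_iff)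
    also have "\<dots> = (real (card A) - 1) * a"
      using \<open>finite A\<close> \<open>i \<in> A\<close> card_gt_0_iff[of A] by (auto simp: of_nat_diff)
    finally show ?thesis .
  qed
  have "card S \<le> card I" "card I > 0" using assms by (auto intro: card_mono simp: card_gt_0_iff)
  then have "real (card S) - 1 \<le> real (card S) / real (card I) * (real (card I) - 1)"
    by (simp add: field_simps)
  then show ?thesis
    using mult_right_mono[OF _ \<open>0 \<le> a\<close>] assms(2,3) sum_eq[of S] sum_eq[of I]
    by (metis mult.assoc subset_refl subsetD)
qed

lemma mono_on_mult_le_integral:
  fixes h :: "real \<Rightarrow> real"
  assumes h: "mono_on {a..b} h" "\<And>q. q \<in> {a..b} \<Longrightarrow> h q \<in> {0..1}" "(h has_integral R) {a..b}"
    and k: "(k has_integral K) {a..b}" "\<And>q. q \<in> {a..b} \<Longrightarrow> h q * (1 - h q) \<le> k q"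
    and p: "p \<in> {a..b}"
  shows "h p * (b - p - R) \<le> K"
proof (rule has_integral_le)
  have "((\<lambda>_. 1) has_integral (b - p)) {p..b}"
    using p has_integral_const_real[of "1::real" p b] by simp
  then have "((\<lambda>q. if q \<in> {p..b} then 1 else 0) has_integral (b - p)) {a..b}"
    using p by (subst has_integral_restrict) auto
  then show "((\<lambda>q. h p * ((if q \<in> {p..b} then 1 else 0) - h q)) has_integral
      h p * (b - p - R)) {a..b}"
    by (intro has_integral_mult_right has_integral_diff h(3))
  fix q assume q: "q \<in> {a..b}"
  have "h p * ((if q \<in> {p..b} then 1 else 0) - h q) \<le> h q * (1 - h q)"
  proof (cases "p \<le> q")
    case True
    then have "h p \<le> h q" by (rule mono_onD[OF h(1) p q])
    then show ?thesis using True q h(2)[OF q] by (auto intro: mult_right_mono)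
  next
    case False
    then have "h p * ((if q \<in> {p..b} then 1 else 0) - h q) = - (h p * h q)" by simp
    also have "\<dots> \<le> h q * (1 - h q)"
      using h(2)[OF p] h(2)[OF q] by (smt (verit) atLeastAtMost_iff mult_nonneg_nonneg)
    finally show ?thesis .
  qed
  then show "h p * ((if q \<in> {p..b} then 1 else 0) - h q) \<le> k q" using k(2)[OF q] by linarith
qed (rule k(1))

section \<open>Functions of a random subset\<close>

definition bernoulli_exp :: "'a set \<Rightarrow> real \<Rightarrow> ('a set \<Rightarrow> real) \<Rightarrow> real" where
  "bernoulli_exp V p f = (\<Sum>E\<in>Pow V. p ^ card E * (1 - p) ^ (card V - card E) * f E)"

definition bernoulli_var :: "'a set \<Rightarrow> real \<Rightarrow> ('a set \<Rightarrow> real) \<Rightarrow> real" where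
  "bernoulli_var V p f = bernoulli_exp V p (\<lambda>E. (f E - bernoulli_exp V p f)\<^sup>2)"

definition discrete_deriv :: "'a \<Rightarrow> ('a set \<Rightarrow> real) \<Rightarrow> 'a set \<Rightarrow> real" where
  "discrete_deriv i f E = f (insert i E) - f (E - {i})"

definition influence :: "'a set \<Rightarrow> real \<Rightarrow> ('a set \<Rightarrow> real) \<Rightarrow> 'a \<Rightarrow> real" where
  "influence V p f i = bernoulli_exp V p (discrete_deriv i f)"

subsection \<open>Expectation\<close>

lemma bernoulli_exp_empty [simp]: "bernoulli_exp {} p f = f {}"
  by (simp add: bernoulli_exp_def)

lemma bernoulli_exp_cong:
  "(\<And>E. E \<subseteq> V \<Longrightarrow> f E = g E) \<Longrightarrow> bernoulli_exp V p f = bernoulli_exp V p g"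
  unfolding bernoulli_exp_def by (intro sum.cong) auto

lemma bernoulli_exp_insert:
  assumes "finite V" "a \<notin> V"
  shows "bernoulli_exp (insert a V) p f =
    p * bernoulli_exp V p (\<lambda>E. f (insert a E)) + (1 - p) * bernoulli_exp V p f"
proof -
  let ?w = "\<lambda>n E. p ^ card E * (1 - p) ^ (n - card E)"
  have inj: "inj_on (insert a) (Pow V)"
    using assms(2) by (intro inj_onI) (metis PowD insert_ident subsetD)
  have disjoint: "Pow V \<inter> insert a ` Pow V = {}" using assms(2) by auto
  have weight_without: "?w (Suc (card V)) E = (1 - p) * ?w (card V) E" if "E \<subseteq> V" for E
    using card_mono[OF assms(1) that] by (simp add: Suc_diff_le)
  have weight_with: "?w (Suc (card V)) (insert a E) = p * ?w (card V) E" if "E \<subseteq> V" for E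
  proof -
    have "finite E" "a \<notin> E" using that assms by (auto intro: finite_subset)
    then show ?thesis by simp
  qed
  have "bernoulli_exp (insert a V) p f =
      (\<Sum>E\<in>Pow V. ?w (Suc (card V)) (insert a E) * f (insert a E))
      + (\<Sum>E\<in>Pow V. ?w (Suc (card V)) E * f E)"
    unfolding bernoulli_exp_def Pow_insert using assms inj disjoint
    by (subst sum.union_disjoint) (auto simp: sum.reindex)
  also have "\<dots> = p * bernoulli_exp V p (\<lambda>E. f (insert a E)) + (1 - p) * bernoulli_exp V p f"
    unfolding bernoulli_exp_def sum_distrib_left
    by (intro arg_cong2[where f = "(+)"] sum.cong)
       (simp_all only: weight_without weight_with Pow_iff mult.assoc)
  finally show ?thesis .
qed

lemma bernoulli_exp_const: "finite V \<Longrightarrow> bernoulli_exp V p (\<lambda>_. c) = c"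
  by (induction V rule: finite_induct) (simp_all add: bernoulli_exp_insert algebra_simps)

lemma bernoulli_exp_add:
  "bernoulli_exp V p (\<lambda>E. f E + g E) = bernoulli_exp V p f + bernoulli_exp V p g"
  by (simp add: bernoulli_exp_def sum.distrib algebra_simps)

lemma bernoulli_exp_diff:
  "bernoulli_exp V p (\<lambda>E. f E - g E) = bernoulli_exp V p f - bernoulli_exp V p g"
  by (simp add: bernoulli_exp_def sum_subtractf algebra_simps)

lemma bernoulli_exp_cmult: "bernoulli_exp V p (\<lambda>E. c * f E) = c * bernoulli_exp V p f"
  by (simp add: bernoulli_exp_def sum_distrib_left algebra_simps)

lemma bernoulli_exp_mono:
  assumes "0 \<le> p" "p \<le> 1" "\<And>E. E \<subseteq> V \<Longrightarrow> f E \<le> g E"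
  shows "bernoulli_exp V p f \<le> bernoulli_exp V p g"
  unfolding bernoulli_exp_def using assms by (intro sum_mono mult_left_mono) auto

lemma bernoulli_exp_nonneg:
  assumes "0 \<le> p" "p \<le> 1" "\<And>E. E \<subseteq> V \<Longrightarrow> 0 \<le> f E"
  shows "0 \<le> bernoulli_exp V p f"
  unfolding bernoulli_exp_def using assms by (intro sum_nonneg mult_nonneg_nonneg) auto

lemma bernoulli_exp_le_const:
  assumes "finite V" "0 \<le> p" "p \<le> 1" "\<And>E. E \<subseteq> V \<Longrightarrow> f E \<le> c"
  shows "bernoulli_exp V p f \<le> c"
  using bernoulli_exp_mono[of p V f "\<lambda>_. c"] assms by (simp add: bernoulli_exp_const)

lemma bernoulli_exp_0: "finite V \<Longrightarrow> bernoulli_exp V 0 f = f {}"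
  by (induction V arbitrary: f rule: finite_induct) (simp_all add: bernoulli_exp_insert)

lemma bernoulli_exp_1: "finite V \<Longrightarrow> bernoulli_exp V 1 f = f V"
  by (induction V arbitrary: f rule: finite_induct) (simp_all add: bernoulli_exp_insert)

lemma bernoulli_exp_Un:
  assumes "finite S" "finite T" "S \<inter> T = {}"
  shows "bernoulli_exp (S \<union> T) p f = bernoulli_exp S p (\<lambda>A. bernoulli_exp T p (\<lambda>B. f (A \<union> B)))"
  using assms(1,3)
proof (induction S arbitrary: f rule: finite_induct)
  case (insert a S)
  then have "bernoulli_exp (insert a (S \<union> T)) p f =
      p * bernoulli_exp (S \<union> T) p (\<lambda>E. f (insert a E)) + (1 - p) * bernoulli_exp (S \<union> T) p f"
    using assms(2) by (intro bernoulli_exp_insert) auto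
  then show ?case using insert by (simp add: bernoulli_exp_insert)
qed simp

lemma bernoulli_exp_image:
  assumes "bij_betw \<phi> V W"
  shows "bernoulli_exp V p (\<lambda>E. f (\<phi> ` E)) = bernoulli_exp W p f"
proof -
  have card_image: "card (\<phi> ` E) = card E" if "E \<subseteq> V" for E
    using that assms by (intro card_image) (auto simp: bij_betw_def intro: inj_on_subset)
  have "bernoulli_exp W p f =
      (\<Sum>E\<in>Pow V. p ^ card (\<phi> ` E) * (1 - p) ^ (card W - card (\<phi> ` E)) * f (\<phi> ` E))"
    unfolding bernoulli_exp_def
    by (rule sum.reindex_bij_betw[OF bij_betw_Pow[OF assms], symmetric])
  also have "\<dots> = bernoulli_exp V p (\<lambda>E. f (\<phi> ` E))"
    unfolding bernoulli_exp_def bij_betw_same_card[OF assms]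
    by (intro sum.cong) (auto simp: card_image)
  finally show ?thesis by simp
qed

subsection \<open>Discrete derivatives\<close>

lemma sum_bernoulli_exp_deriv_insert:
  assumes "finite V" "a \<notin> V"
  shows "(\<Sum>i\<in>insert a V. bernoulli_exp (insert a V) p (\<lambda>E. h (discrete_deriv i f E))) =
    bernoulli_exp V p (\<lambda>E. h (f (insert a E) - f E))
    + p * (\<Sum>i\<in>V. bernoulli_exp V p (\<lambda>E. h (discrete_deriv i (\<lambda>E. f (insert a E)) E)))
    + (1 - p) * (\<Sum>i\<in>V. bernoulli_exp V p (\<lambda>E. h (discrete_deriv i f E)))"
proof -
  have deriv_self: "discrete_deriv a f (insert a E) = f (insert a E) - f E"
      "discrete_deriv a f E = f (insert a E) - f E" if "E \<subseteq> V" for E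
    using that assms(2) by (auto simp: discrete_deriv_def intro!: arg_cong[where f = f])
  have deriv_other: "discrete_deriv i f (insert a E) = discrete_deriv i (\<lambda>E. f (insert a E)) E"
    if "i \<in> V" for i E
  proof -
    have "i \<noteq> a" using that assms(2) by auto
    then show ?thesis by (simp add: discrete_deriv_def insert_commute insert_Diff_if)
  qed
  have "bernoulli_exp (insert a V) p (\<lambda>E. h (discrete_deriv a f E)) =
      bernoulli_exp V p (\<lambda>E. h (f (insert a E) - f E))"
    using assms
    by (simp add: bernoulli_exp_insert deriv_self algebra_simps cong: bernoulli_exp_cong)
  moreover have "bernoulli_exp (insert a V) p (\<lambda>E. h (discrete_deriv i f E)) =
      p * bernoulli_exp V p (\<lambda>E. h (discrete_deriv i (\<lambda>E. f (insert a E)) E))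
      + (1 - p) * bernoulli_exp V p (\<lambda>E. h (discrete_deriv i f E))" if "i \<in> V" for i
    using assms that by (simp add: bernoulli_exp_insert deriv_other)
  ultimately show ?thesis using assms by (simp add: sum.distrib sum_distrib_left)
qed

lemma Margulis_Russo:
  assumes "finite V"
  shows "((\<lambda>p. bernoulli_exp V p f) has_real_derivative (\<Sum>i\<in>V. influence V p f i)) (at p)"
  using assms
proof (induction V arbitrary: f rule: finite_induct)
  case (insert a V)
  let ?g = "\<lambda>E. f (insert a E)"
  have "((\<lambda>p. p * bernoulli_exp V p ?g + (1 - p) * bernoulli_exp V p f) has_real_derivative
      bernoulli_exp V p ?g - bernoulli_exp V p f + p * (\<Sum>i\<in>V. influence V p ?g i)
        + (1 - p) * (\<Sum>i\<in>V. influence V p f i)) (at p)"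
    by (rule derivative_eq_intros insert.IH refl)+ (simp add: algebra_simps)
  moreover have "(\<Sum>i\<in>insert a V. influence (insert a V) p f i) =
      bernoulli_exp V p ?g - bernoulli_exp V p f + p * (\<Sum>i\<in>V. influence V p ?g i)
        + (1 - p) * (\<Sum>i\<in>V. influence V p f i)"
    using sum_bernoulli_exp_deriv_insert[OF insert.hyps, of p "\<lambda>x. x" f]
    by (simp add: influence_def bernoulli_exp_diff)
  ultimately show ?case using insert.hyps by (simp add: bernoulli_exp_insert)
qed simp

lemma has_integral_sum_influence:
  assumes "finite V"
  shows "((\<lambda>p. \<Sum>i\<in>V. influence V p f i) has_integral (f V - f {})) {0..1}"
proof -
  have "((\<lambda>p. \<Sum>i\<in>V. influence V p f i) has_integral
      (bernoulli_exp V 1 f - bernoulli_exp V 0 f)) {0..1}"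
    using Margulis_Russo[OF assms, of f]
    by (intro fundamental_theorem_of_calculus)
       (auto simp: has_real_derivative_iff_has_vector_derivative[symmetric]
         intro: has_field_derivative_at_within)
  then show ?thesis using assms by (simp add: bernoulli_exp_0 bernoulli_exp_1)
qed

lemma discrete_deriv_nonneg:
  assumes "mono f"
  shows "0 \<le> discrete_deriv i f E"
  using monoD[OF assms, of "E - {i}" "insert i E"] by (auto simp: discrete_deriv_def)

lemma influence_nonneg:
  assumes "mono f" "0 \<le> p" "p \<le> 1"
  shows "0 \<le> influence V p f i"
  unfolding influence_def using assms by (intro bernoulli_exp_nonneg discrete_deriv_nonneg)

lemma mono_on_bernoulli_exp:
  assumes "finite V" "mono f"
  shows "mono_on {0..1} (\<lambda>p. bernoulli_exp V p f)"
proof (rule mono_onI)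
  fix p q :: real assume p: "p \<in> {0..1}" and q: "q \<in> {0..1}" and "p \<le> q"
  from \<open>p \<le> q\<close> show "bernoulli_exp V p f \<le> bernoulli_exp V q f"
  proof (rule DERIV_nonneg_imp_nondecreasing)
    fix x assume "p \<le> x" "x \<le> q"
    then have "0 \<le> (\<Sum>i\<in>V. influence V x f i)"
      using p q assms(2) by (intro sum_nonneg influence_nonneg) auto
    then show "\<exists>y. ((\<lambda>p. bernoulli_exp V p f) has_real_derivative y) (at x) \<and> 0 \<le> y"
      using Margulis_Russo[OF assms(1)] by blast
  qed
qed

subsection \<open>Variance\<close>

lemma bernoulli_var_eq:
  assumes "finite V"
  shows "bernoulli_var V p f = bernoulli_exp V p (\<lambda>E. (f E)\<^sup>2) - (bernoulli_exp V p f)\<^sup>2"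
proof -
  define \<mu> where "\<mu> = bernoulli_exp V p f"
  have "bernoulli_var V p f = bernoulli_exp V p (\<lambda>E. (f E)\<^sup>2 - 2 * \<mu> * f E + \<mu>\<^sup>2)"
    by (simp add: bernoulli_var_def \<mu>_def power2_diff algebra_simps)
  also have "\<dots> = bernoulli_exp V p (\<lambda>E. (f E)\<^sup>2) - 2 * \<mu> * bernoulli_exp V p f + \<mu>\<^sup>2"
    using assms
    by (simp only: bernoulli_exp_add bernoulli_exp_diff bernoulli_exp_cmult bernoulli_exp_const)
  finally show ?thesis by (simp add: \<mu>_def power2_eq_square)
qed

lemma bernoulli_var_nonneg: "0 \<le> p \<Longrightarrow> p \<le> 1 \<Longrightarrow> 0 \<le> bernoulli_var V p f"
  unfolding bernoulli_var_def by (intro bernoulli_exp_nonneg) auto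

lemma bernoulli_var_insert:
  assumes "finite V" "a \<notin> V"
  shows "bernoulli_var (insert a V) p f =
    p * bernoulli_var V p (\<lambda>E. f (insert a E)) + (1 - p) * bernoulli_var V p f
    + p * (1 - p) * (bernoulli_exp V p (\<lambda>E. f (insert a E) - f E))\<^sup>2"
  using assms
  by (simp add: bernoulli_var_eq bernoulli_exp_insert bernoulli_exp_diff)
     (simp add: power2_eq_square algebra_simps)

lemma Efron_Stein:
  assumes "finite V" "0 \<le> p" "p \<le> 1"
  shows "bernoulli_var V p f \<le>
    p * (1 - p) * (\<Sum>i\<in>V. bernoulli_exp V p (\<lambda>E. (discrete_deriv i f E)\<^sup>2))"
  using assms(1)
proof (induction V arbitrary: f rule: finite_induct)
  case (insert a V)
  let ?g = "\<lambda>E. f (insert a E)"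
  let ?D = "\<lambda>f. \<Sum>i\<in>V. bernoulli_exp V p (\<lambda>E. (discrete_deriv i f E)\<^sup>2)"
  have "(bernoulli_exp V p (\<lambda>E. ?g E - f E))\<^sup>2 \<le> bernoulli_exp V p (\<lambda>E. (?g E - f E)\<^sup>2)"
    using bernoulli_var_nonneg[OF assms(2,3)] bernoulli_var_eq[OF insert.hyps(1)]
    by (metis diff_ge_0_iff_ge)
  then have "bernoulli_var (insert a V) p f \<le>
      p * (p * (1 - p) * ?D ?g) + (1 - p) * (p * (1 - p) * ?D f)
      + p * (1 - p) * bernoulli_exp V p (\<lambda>E. (?g E - f E)\<^sup>2)"
    unfolding bernoulli_var_insert[OF insert.hyps]
    using insert.IH[of f] insert.IH[of ?g] assms by (intro add_mono mult_left_mono) auto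
  also have "\<dots> = p * (1 - p) *
      (bernoulli_exp V p (\<lambda>E. (?g E - f E)\<^sup>2) + p * ?D ?g + (1 - p) * ?D f)"
    by (simp add: algebra_simps)
  also have "\<dots> = p * (1 - p) *
      (\<Sum>i\<in>insert a V. bernoulli_exp (insert a V) p (\<lambda>E. (discrete_deriv i f E)\<^sup>2))"
    using sum_bernoulli_exp_deriv_insert[OF insert.hyps, of p "\<lambda>x. x\<^sup>2" f] by simp
  finally show ?case .
qed (simp add: bernoulli_var_def)

lemma bernoulli_var_le_sum_influence:
  assumes "finite V" "0 \<le> p" "p \<le> 1" and f: "mono f" "\<And>E. f E \<in> {0..1}"
  shows "bernoulli_var V p f \<le> (\<Sum>i\<in>V. influence V p f i)"
proof -
  have "(discrete_deriv i f E)\<^sup>2 \<le> discrete_deriv i f E" for i E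
  proof -
    have "0 \<le> discrete_deriv i f E" using f(1) by (rule discrete_deriv_nonneg)
    moreover have "discrete_deriv i f E \<le> 1"
      using f(2)[of "insert i E"] f(2)[of "E - {i}"] by (simp add: discrete_deriv_def)
    ultimately show ?thesis by (simp add: power2_eq_square mult_left_le)
  qed
  then have "(\<Sum>i\<in>V. bernoulli_exp V p (\<lambda>E. (discrete_deriv i f E)\<^sup>2)) \<le> (\<Sum>i\<in>V. influence V p f i)"
    unfolding influence_def using assms by (intro sum_mono bernoulli_exp_mono) auto
  moreover have "bernoulli_var V p f \<le>
      1 * (\<Sum>i\<in>V. bernoulli_exp V p (\<lambda>E. (discrete_deriv i f E)\<^sup>2))"
    using assms mult_le_one[of p "1 - p"]
    by (intro order_trans[OF Efron_Stein] mult_right_mono sum_nonneg bernoulli_exp_nonneg) auto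
  ultimately show ?thesis by simp
qed

lemma bernoulli_var_le_diff:
  assumes "finite V" "0 \<le> p" "p \<le> 1" and f: "\<And>E. E \<subseteq> V \<Longrightarrow> 0 \<le> f E \<and> f E \<le> c" and c: "c \<le> 1"
  shows "bernoulli_var V p f \<le> c - bernoulli_exp V p f"
proof -
  let ?\<mu> = "bernoulli_exp V p f"
  have \<mu>: "0 \<le> ?\<mu>" "?\<mu> \<le> c"
    using assms by (auto intro: bernoulli_exp_nonneg bernoulli_exp_le_const)
  have "bernoulli_exp V p (\<lambda>E. (f E)\<^sup>2) \<le> bernoulli_exp V p (\<lambda>E. c * f E)"
    using assms(2,3) f
    by (intro bernoulli_exp_mono) (auto simp: power2_eq_square intro: mult_right_mono)
  then have "bernoulli_var V p f \<le> ?\<mu> * (c - ?\<mu>)"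
    using assms(1)
    by (simp add: bernoulli_var_eq bernoulli_exp_cmult power2_eq_square algebra_simps)
  also have "\<dots> \<le> 1 * (c - ?\<mu>)" using \<mu> c by (intro mult_right_mono) auto
  finally show ?thesis by simp
qed

lemma law_of_total_variance:
  assumes "finite S" "finite T" "S \<inter> T = {}"
  shows "bernoulli_var (S \<union> T) p f = bernoulli_exp S p (\<lambda>A. bernoulli_var T p (\<lambda>B. f (A \<union> B)))
    + bernoulli_var S p (\<lambda>A. bernoulli_exp T p (\<lambda>B. f (A \<union> B)))"
  using assms by (simp add: bernoulli_var_eq bernoulli_exp_Un bernoulli_exp_diff)

lemma influence_bernoulli_exp:
  assumes "finite S" "finite T" "S \<inter> T = {}" "i \<in> S"
  shows "influence S p (\<lambda>A. bernoulli_exp T p (\<lambda>B. f (A \<union> B))) i = influence (S \<union> T) p f i"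
proof -
  have "discrete_deriv i (\<lambda>A. bernoulli_exp T p (\<lambda>B. f (A \<union> B))) A =
      bernoulli_exp T p (\<lambda>B. discrete_deriv i f (A \<union> B))" for A
  proof -
    have "(A - {i}) \<union> B = A \<union> B - {i}" if "B \<subseteq> T" for B using that assms by auto
    then show ?thesis
      by (simp add: discrete_deriv_def bernoulli_exp_diff cong: bernoulli_exp_cong)
  qed
  then show ?thesis
    unfolding influence_def bernoulli_exp_Un[OF assms(1-3)] by (rule bernoulli_exp_cong)
qed

text \<open>Conditionally on \<open>E \<inter> S\<close>, \<open>f E\<close> takes values in \<open>[0, g (E \<inter> S)]\<close>.\<close>

lemma bernoulli_var_le_conditional:
  assumes V: "finite V" "S \<subseteq> V" and p: "0 \<le> p" "p \<le> 1"
    and f: "mono f" "\<And>E. f E \<in> {0..1}"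
    and g: "\<And>E. g E \<le> 1" "\<And>E. E \<subseteq> V \<Longrightarrow> f E \<le> g (E \<inter> S)"
  shows "bernoulli_var V p f \<le>
    (bernoulli_exp S p g - bernoulli_exp V p f) + (\<Sum>i\<in>S. influence V p f i)"
proof -
  define T where "T = V - S"
  have ST: "finite S" "finite T" "S \<inter> T = {}" and V_eq: "V = S \<union> T"
    using V finite_subset by (auto simp: T_def)
  define u where "u = (\<lambda>A. bernoulli_exp T p (\<lambda>B. f (A \<union> B)))"
  have "mono u"
    unfolding u_def using f(1) p by (intro monoI bernoulli_exp_mono) (auto elim!: monoD)
  moreover have "u A \<in> {0..1}" for A
    unfolding u_def using f(2) ST p
    by (auto intro!: bernoulli_exp_nonneg bernoulli_exp_le_const)
  ultimately have between: "bernoulli_var S p u \<le> (\<Sum>i\<in>S. influence V p f i)"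
    using bernoulli_var_le_sum_influence[OF ST(1) p, of u] influence_bernoulli_exp[OF ST]
    by (simp add: u_def V_eq)
  have "bernoulli_var T p (\<lambda>B. f (A \<union> B)) \<le> g A - u A" if "A \<subseteq> S" for A
    unfolding u_def
  proof (intro bernoulli_var_le_diff ST p g(1))
    fix B assume "B \<subseteq> T"
    then have "(A \<union> B) \<inter> S = A" "A \<union> B \<subseteq> V" using that V by (auto simp: T_def)
    then show "0 \<le> f (A \<union> B) \<and> f (A \<union> B) \<le> g A" using g(2)[of "A \<union> B"] f(2)[of "A \<union> B"] by simp
  qed
  then have "bernoulli_exp S p (\<lambda>A. bernoulli_var T p (\<lambda>B. f (A \<union> B))) \<le>
      bernoulli_exp S p (\<lambda>A. g A - u A)"
    by (intro bernoulli_exp_mono p)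
  also have "\<dots> = bernoulli_exp S p g - bernoulli_exp V p f"
    unfolding V_eq u_def bernoulli_exp_Un[OF ST] by (rule bernoulli_exp_diff)
  finally show ?thesis
    using between unfolding V_eq u_def law_of_total_variance[OF ST] by linarith
qed

section \<open>Linear codes on the erasure channel\<close>

definition linear_code :: "'i set \<Rightarrow> ('i \<Rightarrow> bool) set \<Rightarrow> bool" where
  "linear_code I C \<longleftrightarrow> finite I \<and> (\<lambda>_. False) \<in> C \<and>
     (\<forall>c\<in>C. \<forall>d\<in>C. (\<lambda>x. c x \<noteq> d x) \<in> C) \<and> (\<forall>c\<in>C. Collect c \<subseteq> I)"

definition code_rate :: "'i set \<Rightarrow> ('i \<Rightarrow> bool) set \<Rightarrow> real" where
  "code_rate I C = log 2 (real (card C)) / real (card I)"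

definition shortened_code :: "('i \<Rightarrow> bool) set \<Rightarrow> 'i set \<Rightarrow> ('i \<Rightarrow> bool) set" where
  "shortened_code C E = {c \<in> C. Collect c \<subseteq> E}"

definition punctured_code :: "'i set \<Rightarrow> ('i \<Rightarrow> bool) set \<Rightarrow> ('i \<Rightarrow> bool) set" where
  "punctured_code S C = (\<lambda>c x. x \<in> S \<and> c x) ` C"

text \<open>By linearity, bit \<open>i\<close> is not determined by the unerased positions other than \<open>i\<close> iff some
  codeword that is nonzero at \<open>i\<close> is supported on \<open>i\<close> and the erased positions \<open>E\<close>.\<close>

definition exit_ind :: "('i \<Rightarrow> bool) set \<Rightarrow> 'i \<Rightarrow> 'i set \<Rightarrow> real" where
  "exit_ind C i E = of_bool (\<exists>c\<in>shortened_code C (insert i E). c i)"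

definition exit_function :: "'i set \<Rightarrow> ('i \<Rightarrow> bool) set \<Rightarrow> 'i \<Rightarrow> real \<Rightarrow> real" where
  "exit_function I C i p = bernoulli_exp I p (exit_ind C i)"

lemma linear_code_finite_coords: "linear_code I C \<Longrightarrow> finite I"
  by (simp add: linear_code_def)

lemma linear_code_xor: "linear_code I C \<Longrightarrow> c \<in> C \<Longrightarrow> d \<in> C \<Longrightarrow> (\<lambda>x. c x \<noteq> d x) \<in> C"
  by (simp add: linear_code_def)

lemma finite_linear_code:
  assumes "linear_code I C"
  shows "finite C"
proof (rule finite_imageD[of Collect])
  have "Collect ` C \<subseteq> Pow I" "finite I" using assms by (auto simp: linear_code_def)
  then show "finite (Collect ` C)" by (meson finite_Pow_iff finite_subset)
qed (auto simp: inj_on_def set_eq_iff)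

lemma linear_code_shortened: "linear_code I C \<Longrightarrow> linear_code I (shortened_code C E)"
  by (fastforce simp: linear_code_def shortened_code_def)

lemma card_linear_code_nonzero_bit:
  assumes C: "linear_code I C" and c: "c \<in> C" "c i"
  shows "card C = 2 * card {d \<in> C. \<not> d i}"
proof -
  define t where "t = (\<lambda>d x. d x \<noteq> c x)"
  have "t d \<in> C" if "d \<in> C" for d using linear_code_xor[OF C that c(1)] by (simp add: t_def)
  moreover have "t (t d) = d" "t d i \<longleftrightarrow> \<not> d i" for d using c(2) by (auto simp: t_def)
  ultimately have "bij_betw t {d \<in> C. \<not> d i} {d \<in> C. d i}"
    by (intro bij_betw_byWitness[where f' = t]) auto
  then have "card {d \<in> C. d i} = card {d \<in> C. \<not> d i}" by (rule bij_betw_same_card[symmetric])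
  moreover have "card C = card {d \<in> C. d i} + card {d \<in> C. \<not> d i}"
  proof -
    have "C = {d \<in> C. d i} \<union> {d \<in> C. \<not> d i}" by auto
    also have "card \<dots> = card {d \<in> C. d i} + card {d \<in> C. \<not> d i}"
      using finite_linear_code[OF C] by (intro card_Un_disjoint) auto
    finally show ?thesis .
  qed
  ultimately show ?thesis by simp
qed

subsection \<open>The area theorem\<close>

lemma discrete_deriv_log_card_shortened:
  assumes "linear_code I C"
  shows "discrete_deriv i (\<lambda>E. log 2 (real (card (shortened_code C E)))) E = exit_ind C i E"
proof -
  let ?D = "shortened_code C (insert i E)"
  have D: "linear_code I ?D" using assms by (rule linear_code_shortened)
  have remove: "shortened_code C (E - {i}) = {c \<in> ?D. \<not> c i}" by (auto simp: shortened_code_def)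
  have "(\<lambda>_. False) \<in> {c \<in> ?D. \<not> c i}" using D by (simp add: linear_code_def)
  then have pos: "card {c \<in> ?D. \<not> c i} > 0"
    using finite_linear_code[OF D] by (auto simp: card_gt_0_iff)
  have "log 2 (real (card ?D)) - log 2 (real (card {c \<in> ?D. \<not> c i})) = exit_ind C i E"
  proof (cases "\<exists>c\<in>?D. c i")
    case True
    then have "card ?D = 2 * card {c \<in> ?D. \<not> c i}"
      using card_linear_code_nonzero_bit[OF D] by blast
    then show ?thesis using True pos by (simp add: exit_ind_def log_mult)
  next
    case False
    then have "{c \<in> ?D. \<not> c i} = ?D" by auto
    then show ?thesis using False by (simp add: exit_ind_def)
  qed
  then show ?thesis by (simp add: discrete_deriv_def remove)
qed

lemma area_theorem:
  assumes "linear_code I C"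
  shows "((\<lambda>p. \<Sum>i\<in>I. exit_function I C i p) has_integral log 2 (real (card C))) {0..1}"
proof -
  have "discrete_deriv i (\<lambda>E. log 2 (real (card (shortened_code C E)))) = exit_ind C i" for i
    using discrete_deriv_log_card_shortened[OF assms] by blast
  moreover have "shortened_code C I = C" "shortened_code C {} = {\<lambda>_. False}"
    using assms by (auto simp: linear_code_def shortened_code_def)
  ultimately show ?thesis
    using has_integral_sum_influence[OF linear_code_finite_coords[OF assms],
        of "\<lambda>E. log 2 (real (card (shortened_code C E)))"]
    by (simp add: influence_def exit_function_def)
qed

subsection \<open>Bit-MAP decoding\<close>

lemma bit_undetermined_iff:
  assumes C: "linear_code I C" and X: "X \<in> C"
  shows "(\<exists>c\<in>C. (\<forall>j\<in>I - E. c j = X j) \<and> c i \<noteq> X i) \<longleftrightarrow> (\<exists>d\<in>shortened_code C E. d i)"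
proof
  assume "\<exists>c\<in>C. (\<forall>j\<in>I - E. c j = X j) \<and> c i \<noteq> X i"
  then obtain c where c: "c \<in> C" "\<forall>j\<in>I - E. c j = X j" "c i \<noteq> X i" by blast
  have "Collect c \<subseteq> I" "Collect X \<subseteq> I" using C X c(1) by (auto simp: linear_code_def)
  then have "(\<lambda>x. c x \<noteq> X x) \<in> shortened_code C E"
    using linear_code_xor[OF C c(1) X] c(2) by (auto simp: shortened_code_def)
  then show "\<exists>d\<in>shortened_code C E. d i" using c(3) by (intro bexI[of _ "\<lambda>x. c x \<noteq> X x"])
next
  assume "\<exists>d\<in>shortened_code C E. d i"
  then obtain d where d: "d \<in> C" "Collect d \<subseteq> E" "d i" by (auto simp: shortened_code_def)
  then show "\<exists>c\<in>C. (\<forall>j\<in>I - E. c j = X j) \<and> c i \<noteq> X i"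
    using linear_code_xor[OF C d(1) X] by (intro bexI[of _ "\<lambda>x. d x \<noteq> X x"]) auto
qed

lemma bit_MAP_Pb_eq:
  assumes "linear_code I C"
  shows "bit_MAP_Pb I C p =
    (\<Sum>i\<in>I. bernoulli_exp I p (\<lambda>E. of_bool (\<exists>c\<in>shortened_code C E. c i))) / real (card I)"
proof -
  have "C \<noteq> {}" "finite C" using assms finite_linear_code by (auto simp: linear_code_def)
  moreover have "{X\<in>C. \<exists>c\<in>C. (\<forall>j\<in>I - E. c j = X j) \<and> c i \<noteq> X i} =
      {X\<in>C. \<exists>c\<in>shortened_code C E. c i}" for i E
    by (intro Collect_cong conj_cong refl bit_undetermined_iff assms)
  ultimately have "1 / real (card C) *
      real (card {X\<in>C. \<exists>c\<in>C. (\<forall>j\<in>I - E. c j = X j) \<and> c i \<noteq> X i}) =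
      of_bool (\<exists>c\<in>shortened_code C E. c i)" for i E
    by (simp only:) auto
  then show ?thesis
    unfolding bit_MAP_Pb_def bernoulli_exp_def by (simp only: divide_inverse mult.commute)
qed

lemma bit_MAP_Pb_nonneg: "0 \<le> p \<Longrightarrow> p \<le> 1 \<Longrightarrow> 0 \<le> bit_MAP_Pb I C p"
  unfolding bit_MAP_Pb_def by (intro mult_nonneg_nonneg sum_nonneg) auto

lemma bit_MAP_Pb_le_mean_exit_function:
  assumes "linear_code I C" "0 \<le> p" "p \<le> 1"
  shows "bit_MAP_Pb I C p \<le> (\<Sum>i\<in>I. exit_function I C i p) / real (card I)"
  unfolding bit_MAP_Pb_eq[OF assms(1)] exit_function_def using assms
  by (intro divide_right_mono sum_mono bernoulli_exp_mono)
     (auto simp: exit_ind_def shortened_code_def)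

subsection \<open>EXIT functions\<close>

lemma exit_ind_cases: "exit_ind C i E = 0 \<or> exit_ind C i E = 1"
  by (auto simp: exit_ind_def)

lemma mono_exit_ind: "mono (exit_ind C i)"
proof (rule monoI)
  fix A B :: "'a set" assume "A \<subseteq> B"
  then have "shortened_code C (insert i A) \<subseteq> shortened_code C (insert i B)"
    by (auto simp: shortened_code_def)
  then show "exit_ind C i A \<le> exit_ind C i B" by (auto simp: exit_ind_def of_bool_def)
qed

lemma influence_exit_ind_self: "finite I \<Longrightarrow> influence I p (exit_ind C i) i = 0"
  by (simp add: influence_def discrete_deriv_def[abs_def] exit_ind_def bernoulli_exp_const)

lemma exit_function_bounds:
  assumes "finite I" "0 \<le> p" "p \<le> 1"
  shows "exit_function I C i p \<in> {0..1}"
  unfolding exit_function_def using assms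
  by (auto simp: exit_ind_def intro!: bernoulli_exp_nonneg bernoulli_exp_le_const)

lemma bernoulli_var_exit_ind:
  assumes "finite I"
  shows "bernoulli_var I p (exit_ind C i) = exit_function I C i p * (1 - exit_function I C i p)"
proof -
  have "(exit_ind C i E)\<^sup>2 = exit_ind C i E" for E using exit_ind_cases[of C i E] by auto
  then have "bernoulli_var I p (exit_ind C i) = exit_function I C i p - (exit_function I C i p)\<^sup>2"
    by (simp add: bernoulli_var_eq[OF assms] exit_function_def)
  then show ?thesis by (simp add: power2_eq_square algebra_simps)
qed

lemma exit_ind_punctured_le:
  assumes "i \<in> S" "punctured_code S C \<subseteq> D"
  shows "exit_ind C i E \<le> exit_ind D i (E \<inter> S)"
proof -
  have "\<exists>d\<in>shortened_code D (insert i (E \<inter> S)). d i"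
    if "c \<in> shortened_code C (insert i E)" "c i" for c
    using that assms
    by (intro bexI[of _ "\<lambda>x. x \<in> S \<and> c x"]) (auto simp: shortened_code_def punctured_code_def)
  then show ?thesis by (auto simp: exit_ind_def of_bool_def)
qed

lemma exit_function_variance_le:
  assumes "finite I" "S \<subseteq> I" "i \<in> S" "punctured_code S C \<subseteq> D" "0 \<le> p" "p \<le> 1"
  shows "exit_function I C i p * (1 - exit_function I C i p) \<le>
    (exit_function S D i p - exit_function I C i p) + (\<Sum>j\<in>S. influence I p (exit_ind C i) j)"
proof -
  have "exit_ind C' i E \<in> {0..1}" "exit_ind C' i E \<le> 1" for C' :: "('a \<Rightarrow> bool) set" and E
    using exit_ind_cases[of C' i E] by auto
  then have "bernoulli_var I p (exit_ind C i) \<le>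
      (exit_function S D i p - exit_function I C i p) + (\<Sum>j\<in>S. influence I p (exit_ind C i) j)"
    unfolding exit_function_def
    by (intro bernoulli_var_le_conditional mono_exit_ind exit_ind_punctured_le assms)
  then show ?thesis by (simp only: bernoulli_var_exit_ind[OF assms(1)])
qed

subsection \<open>Doubly transitive codes\<close>

definition code_automorphism :: "'i set \<Rightarrow> ('i \<Rightarrow> bool) set \<Rightarrow> ('i \<Rightarrow> 'i) \<Rightarrow> bool" where
  "code_automorphism I C \<phi> \<longleftrightarrow> \<phi> permutes I \<and> (\<forall>c. c \<circ> \<phi> \<in> C \<longleftrightarrow> c \<in> C)"

text \<open>The first clause follows from the second unless \<open>card I = 2\<close>.\<close>

definition doubly_transitive_code :: "'i set \<Rightarrow> ('i \<Rightarrow> bool) set \<Rightarrow> bool" where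
  "doubly_transitive_code I C \<longleftrightarrow>
     (\<forall>i\<in>I. \<forall>j\<in>I. \<exists>\<phi>. code_automorphism I C \<phi> \<and> \<phi> i = j) \<and>
     (\<forall>i\<in>I. \<forall>j\<in>I - {i}. \<forall>k\<in>I - {i}. \<exists>\<phi>. code_automorphism I C \<phi> \<and> \<phi> i = i \<and> \<phi> j = k)"

lemma exit_ind_automorphism:
  assumes "code_automorphism I C \<phi>"
  shows "exit_ind C (\<phi> i) (\<phi> ` E) = exit_ind C i E"
proof -
  have \<phi>: "\<phi> permutes I" and C: "\<And>c. c \<circ> \<phi> \<in> C \<longleftrightarrow> c \<in> C"
    using assms by (auto simp: code_automorphism_def)
  have shortened: "c \<circ> \<phi> \<in> shortened_code C A \<longleftrightarrow> c \<in> shortened_code C (\<phi> ` A)" for c A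
  proof -
    have "Collect (c \<circ> \<phi>) \<subseteq> A \<longleftrightarrow> Collect c \<subseteq> \<phi> ` A"
      using permutes_surj[OF \<phi>] permutes_inj[OF \<phi>]
      by (auto simp: subset_iff image_iff inj_eq) (metis surjD)
    then show ?thesis by (simp add: shortened_code_def C)
  qed
  have "(\<exists>c\<in>shortened_code C (\<phi> ` insert i E). c (\<phi> i)) \<longleftrightarrow>
      (\<exists>d\<in>shortened_code C (insert i E). d i)"
  proof
    assume "\<exists>c\<in>shortened_code C (\<phi> ` insert i E). c (\<phi> i)"
    then show "\<exists>d\<in>shortened_code C (insert i E). d i" using shortened by (metis comp_apply)
  next
    assume "\<exists>d\<in>shortened_code C (insert i E). d i"
    then obtain d where d: "d \<in> shortened_code C (insert i E)" "d i" by blast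
    have "(d \<circ> inv \<phi>) \<circ> \<phi> = d" using permutes_inj[OF \<phi>] by (simp add: comp_assoc)
    then show "\<exists>c\<in>shortened_code C (\<phi> ` insert i E). c (\<phi> i)"
      using d shortened by (metis comp_apply)
  qed
  then show ?thesis by (simp add: exit_ind_def)
qed

lemma exit_function_automorphism:
  assumes "code_automorphism I C \<phi>"
  shows "exit_function I C (\<phi> i) p = exit_function I C i p"
  using bernoulli_exp_image[of \<phi> I I p "exit_ind C (\<phi> i)"] assms
  by (simp add: exit_function_def exit_ind_automorphism[OF assms] code_automorphism_def
      permutes_imp_bij)

lemma influence_automorphism:
  assumes "code_automorphism I C \<phi>" "\<phi> i = i"
  shows "influence I p (exit_ind C i) (\<phi> j) = influence I p (exit_ind C i) j"
proof -
  have \<phi>: "\<phi> permutes I" using assms(1) by (simp add: code_automorphism_def)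
  have "exit_ind C i (\<phi> ` E) = exit_ind C i E" for E
    using exit_ind_automorphism[OF assms(1), of i E] assms(2) by simp
  moreover have "insert (\<phi> j) (\<phi> ` E) = \<phi> ` insert j E" "\<phi> ` E - {\<phi> j} = \<phi> ` (E - {j})" for E
    using permutes_inj[OF \<phi>] by (simp_all add: image_set_diff)
  ultimately have "discrete_deriv (\<phi> j) (exit_ind C i) (\<phi> ` E) =
      discrete_deriv j (exit_ind C i) E" for E
    by (simp only: discrete_deriv_def)
  then show ?thesis
    using permutes_imp_bij[OF \<phi>]
      bernoulli_exp_image[of \<phi> I I p "discrete_deriv (\<phi> j) (exit_ind C i)"]
    by (simp add: influence_def)
qed

lemma sum_exit_function:
  assumes "doubly_transitive_code I C" "i \<in> I"
  shows "(\<Sum>j\<in>I. exit_function I C j p) = real (card I) * exit_function I C i p"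
proof -
  have "exit_function I C j p = exit_function I C i p" if "j \<in> I" for j
    using assms that exit_function_automorphism[of I C] by (metis doubly_transitive_code_def)
  then show ?thesis by simp
qed

lemma exit_function_has_integral:
  assumes "linear_code I C" "doubly_transitive_code I C" "i \<in> I"
  shows "(exit_function I C i has_integral code_rate I C) {0..1}"
proof -
  have "card I > 0" using assms by (auto simp: linear_code_def card_gt_0_iff)
  then show ?thesis
    using has_integral_mult_right[OF area_theorem[OF assms(1)], of "1 / real (card I)"]
    by (simp add: sum_exit_function[OF assms(2,3)] code_rate_def)
qed

lemma bit_MAP_Pb_le_exit_function:
  assumes "linear_code I C" "doubly_transitive_code I C" "i \<in> I" "0 \<le> p" "p \<le> 1"
  shows "bit_MAP_Pb I C p \<le> exit_function I C i p"
proof -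
  have "card I > 0" using assms by (auto simp: linear_code_def card_gt_0_iff)
  then show ?thesis
    using bit_MAP_Pb_le_mean_exit_function[OF assms(1,4,5)]
    by (simp add: sum_exit_function[OF assms(2,3)])
qed

lemma sum_influence_subset_le:
  assumes I: "finite I" "S \<subseteq> I" "i \<in> S" and C: "doubly_transitive_code I C" and p: "0 \<le> p" "p \<le> 1"
  shows "(\<Sum>j\<in>S. influence I p (exit_ind C i) j) \<le>
    real (card S) / real (card I) * (\<Sum>j\<in>I. influence I p (exit_ind C i) j)"
proof -
  have "influence I p (exit_ind C i) j = influence I p (exit_ind C i) k"
    if "j \<in> I - {i}" "k \<in> I - {i}" for j k
    using C that I influence_automorphism[of I C _ i p j]
    unfolding doubly_transitive_code_def by (metis subsetD)
  then obtain a where "\<And>j. j \<in> I - {i} \<Longrightarrow> influence I p (exit_ind C i) j = a" "0 \<le> a"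
    using influence_nonneg[OF mono_exit_ind p] by (metis order_refl)
  then show ?thesis
    by (intro sum_subset_le_card_ratio[OF I influence_exit_ind_self[OF I(1)]])
qed

lemma exit_function_sharp_threshold:
  assumes C: "linear_code I C" "doubly_transitive_code I C"
    and D: "linear_code S D" "doubly_transitive_code S D"
    and S: "S \<subseteq> I" "punctured_code S C \<subseteq> D"
    and i: "i \<in> S" and p: "p \<in> {0..1}"
  shows "exit_function I C i p * (1 - p - code_rate I C) \<le>
    code_rate S D - code_rate I C + real (card S) / real (card I)"
proof -
  let ?h = "exit_function I C i" and ?f = "exit_ind C i"
  let ?\<rho> = "real (card S) / real (card I)"
  have I: "finite I" "i \<in> I" using C S i by (auto simp: linear_code_def)
  have "?h p * (1 - p - code_rate I C) \<le> (code_rate S D - code_rate I C) + ?\<rho> * (?f I - ?f {})"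
  proof (rule mono_on_mult_le_integral[OF _ _ _ _ _ p])
    show "mono_on {0..1} ?h"
      unfolding exit_function_def[abs_def] using I(1) mono_exit_ind
      by (rule mono_on_bernoulli_exp)
    show "(?h has_integral code_rate I C) {0..1}"
      by (intro exit_function_has_integral C I)
    show "((\<lambda>q. (exit_function S D i q - ?h q) + ?\<rho> * (\<Sum>j\<in>I. influence I q ?f j))
        has_integral (code_rate S D - code_rate I C) + ?\<rho> * (?f I - ?f {})) {0..1}"
      by (intro has_integral_add has_integral_diff has_integral_mult_right
          exit_function_has_integral has_integral_sum_influence C D I i)
    fix q :: real assume "q \<in> {0..1}"
    then have q: "0 \<le> q" "q \<le> 1" by auto
    show "?h q \<in> {0..1}" using I(1) q by (rule exit_function_bounds)
    show "?h q * (1 - ?h q) \<le> (exit_function S D i q - ?h q) + ?\<rho> * (\<Sum>j\<in>I. influence I q ?f j)"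
      using exit_function_variance_le[OF I(1) S(1) i S(2) q]
        sum_influence_subset_le[OF I(1) S(1) i C(2) q] by linarith
  qed
  also have "?\<rho> * (?f I - ?f {}) \<le> ?\<rho> * 1"
    using exit_ind_cases[of C i I] exit_ind_cases[of C i "{}"] by (intro mult_left_mono) auto
  finally show ?thesis by simp
qed

section \<open>Reed--Muller codes\<close>

definition RM_eval :: "nat \<Rightarrow> nat set set \<Rightarrow> nat set \<Rightarrow> bool" where
  "RM_eval m A x \<longleftrightarrow> x \<subseteq> {..<m} \<and> odd (card {T\<in>A. T \<subseteq> x})"

definition RM_monomial :: "nat \<Rightarrow> nat set \<Rightarrow> nat set \<Rightarrow> bool" where
  "RM_monomial m T x \<longleftrightarrow> x \<subseteq> {..<m} \<and> T \<subseteq> x"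

lemma RM_code_eq: "RM_code v m = RM_eval m ` Pow (RM_monomials v m)"
  by (auto simp: RM_code_def RM_eval_def[abs_def])

lemma finite_RM_monomials: "finite (RM_monomials v m)"
  by (rule finite_subset[of _ "Pow {..<m}"]) (auto simp: RM_monomials_def)

lemma finite_RM_coords: "finite (RM_coords m)"
  by (simp add: RM_coords_def)

lemma card_RM_coords: "card (RM_coords m) = 2 ^ m"
  by (simp add: RM_coords_def card_Pow)

lemma RM_eval_empty: "RM_eval m {} = (\<lambda>_. False)"
  by (simp add: RM_eval_def fun_eq_iff)

lemma RM_eval_singleton: "RM_eval m {T} = RM_monomial m T"
proof
  fix x
  have "{S\<in>{T}. S \<subseteq> x} = (if T \<subseteq> x then {T} else {})" by auto
  then show "RM_eval m {T} x = RM_monomial m T x" by (simp add: RM_eval_def RM_monomial_def)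
qed

lemma RM_eval_sym_diff:
  assumes "finite A" "finite B"
  shows "RM_eval m (sym_diff A B) = (\<lambda>x. RM_eval m A x \<noteq> RM_eval m B x)"
proof
  fix x
  have "{T\<in>sym_diff A B. T \<subseteq> x} = sym_diff {T\<in>A. T \<subseteq> x} {T\<in>B. T \<subseteq> x}" by auto
  then show "RM_eval m (sym_diff A B) x = (RM_eval m A x \<noteq> RM_eval m B x)"
    using odd_card_sym_diff[of "{T\<in>A. T \<subseteq> x}" "{T\<in>B. T \<subseteq> x}"] assms
    by (auto simp: RM_eval_def)
qed

subsection \<open>Closure properties\<close>

lemma RM_code_subset: "c \<in> RM_code v m \<Longrightarrow> c x \<Longrightarrow> x \<subseteq> {..<m}"
  by (auto simp: RM_code_def)

lemma RM_code_zero: "(\<lambda>_. False) \<in> RM_code v m"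
  unfolding RM_code_eq by (rule image_eqI[of _ _ "{}"]) (simp_all add: RM_eval_empty)

lemma RM_code_xor:
  assumes "c \<in> RM_code v m" "d \<in> RM_code v m"
  shows "(\<lambda>x. c x \<noteq> d x) \<in> RM_code v m"
proof -
  obtain A B where AB: "A \<subseteq> RM_monomials v m" "B \<subseteq> RM_monomials v m"
      and cd: "c = RM_eval m A" "d = RM_eval m B"
    using assms by (auto simp: RM_code_eq)
  then have "finite A" "finite B" using finite_RM_monomials finite_subset by blast+
  then have "(\<lambda>x. c x \<noteq> d x) = RM_eval m (sym_diff A B)" by (simp add: RM_eval_sym_diff cd)
  then show ?thesis using AB by (auto simp: RM_code_eq)
qed

lemma RM_code_monomial: "T \<subseteq> {..<m} \<Longrightarrow> card T \<le> v \<Longrightarrow> RM_monomial m T \<in> RM_code v m"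
  unfolding RM_code_eq RM_eval_singleton[symmetric] by (auto simp: RM_monomials_def)

lemma RM_code_induct [consumes 1, case_names zero monomial xor]:
  assumes "c \<in> RM_code v m"
    and zero: "P (\<lambda>_. False)"
    and monomial: "\<And>T. T \<subseteq> {..<m} \<Longrightarrow> card T \<le> v \<Longrightarrow> P (RM_monomial m T)"
    and xor: "\<And>c d. P c \<Longrightarrow> P d \<Longrightarrow> P (\<lambda>x. c x \<noteq> d x)"
  shows "P c"
proof -
  obtain A where A: "A \<subseteq> RM_monomials v m" "c = RM_eval m A"
    using assms(1) by (auto simp: RM_code_eq)
  have "finite A" using A finite_RM_monomials finite_subset by blast
  then have "P (RM_eval m A)" using A(1)
  proof (induction A rule: finite_induct)
    case empty
    then show ?case using zero by (simp add: RM_eval_empty)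
  next
    case (insert T A)
    have "sym_diff {T} A = insert T A" using insert by auto
    then have "RM_eval m (insert T A) = (\<lambda>x. RM_monomial m T x \<noteq> RM_eval m A x)"
      using RM_eval_sym_diff[of "{T}" A m] insert by (simp add: RM_eval_singleton)
    moreover have "P (RM_monomial m T)"
      using insert by (intro monomial) (auto simp: RM_monomials_def)
    ultimately show ?case using insert xor by simp
  qed
  then show ?thesis using A by simp
qed

lemma linear_RM_code: "linear_code (RM_coords m) (RM_code v m)"
  unfolding linear_code_def
  by (intro conjI ballI finite_RM_coords RM_code_zero RM_code_xor)
     (auto simp: RM_coords_def dest: RM_code_subset)

lemma RM_code_mono: "v \<le> w \<Longrightarrow> RM_code v m \<subseteq> RM_code w m"
  by (auto simp: RM_code_eq RM_monomials_def intro!: imageI)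

lemma RM_code_conj:
  assumes "c \<in> RM_code v m" "d \<in> RM_code w m"
  shows "(\<lambda>x. c x \<and> d x) \<in> RM_code (v + w) m"
  using assms(1)
proof (induction rule: RM_code_induct)
  case (monomial T)
  show ?case using assms(2)
  proof (induction rule: RM_code_induct)
    case (monomial U)
    have "card (T \<union> U) \<le> v + w" using card_Un_le[of T U] monomial \<open>card T \<le> v\<close> by linarith
    then have "RM_monomial m (T \<union> U) \<in> RM_code (v + w) m"
      using monomial \<open>T \<subseteq> _\<close> by (intro RM_code_monomial) auto
    moreover have "RM_monomial m (T \<union> U) = (\<lambda>x. RM_monomial m T x \<and> RM_monomial m U x)"
      by (auto simp: RM_monomial_def fun_eq_iff)
    ultimately show ?case by simp
  next
    case (xor c d)
    have "(\<lambda>x. RM_monomial m T x \<and> c x \<noteq> d x) =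
      (\<lambda>x. (RM_monomial m T x \<and> c x) \<noteq> (RM_monomial m T x \<and> d x))" by auto
    then show ?case using RM_code_xor[OF xor] by simp
  qed (simp add: RM_code_zero)
next
  case (xor a b)
  have "(\<lambda>x. a x \<noteq> b x \<and> d x) = (\<lambda>x. (a x \<and> d x) \<noteq> (b x \<and> d x))" by auto
  then show ?case using RM_code_xor[OF xor] by simp
qed (simp add: RM_code_zero)

lemma RM_code_comp_affine:
  assumes \<phi>: "\<And>x. \<phi> x \<subseteq> {..<m} \<longleftrightarrow> x \<subseteq> {..<m}"
    and affine: "\<And>a. a < m \<Longrightarrow> RM_monomial m {a} \<circ> \<phi> \<in> RM_code 1 m"
    and c: "c \<in> RM_code v m"
  shows "c \<circ> \<phi> \<in> RM_code v m"
  using c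
proof (induction rule: RM_code_induct)
  case zero
  then show ?case by (simp add: RM_code_zero comp_def)
next
  case (monomial T)
  then have "finite T" by (auto intro: finite_subset)
  then have "T \<subseteq> {..<m} \<Longrightarrow> RM_monomial m T \<circ> \<phi> \<in> RM_code (card T) m"
  proof (induction T rule: finite_induct)
    case empty
    have "RM_monomial m {} \<circ> \<phi> = RM_monomial m {}" by (simp add: RM_monomial_def \<phi> fun_eq_iff)
    then show ?case by (simp add: RM_code_monomial)
  next
    case (insert a T)
    then have "(\<lambda>x. (RM_monomial m {a} \<circ> \<phi>) x \<and> (RM_monomial m T \<circ> \<phi>) x) \<in> RM_code (1 + card T) m"
      by (intro RM_code_conj affine) auto
    moreover have "(\<lambda>x. (RM_monomial m {a} \<circ> \<phi>) x \<and> (RM_monomial m T \<circ> \<phi>) x) =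
        RM_monomial m (insert a T) \<circ> \<phi>"
      by (auto simp: RM_monomial_def fun_eq_iff)
    ultimately show ?case using insert.hyps by (simp add: comp_def)
  qed
  then show ?case using monomial RM_code_mono by blast
next
  case (xor c d)
  then show ?case using RM_code_xor by (simp add: comp_def)
qed

lemma punctured_RM_code_subset:
  assumes "n \<le> m"
  shows "punctured_code (RM_coords n) (RM_code v m) \<subseteq> RM_code v n"
proof -
  have "(\<lambda>x. x \<in> RM_coords n \<and> c x) \<in> RM_code v n" if "c \<in> RM_code v m" for c
    using that
  proof (induction rule: RM_code_induct)
    case (monomial T)
    show ?case
    proof (cases "T \<subseteq> {..<n}")
      case True
      have "(\<lambda>x. x \<in> RM_coords n \<and> RM_monomial m T x) = RM_monomial n T"
        using assms by (fastforce simp: RM_coords_def RM_monomial_def)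
      then show ?thesis using RM_code_monomial[OF True monomial(2)] by simp
    next
      case False
      then have "(\<lambda>x. x \<in> RM_coords n \<and> RM_monomial m T x) = (\<lambda>_. False)"
        by (auto simp: RM_coords_def RM_monomial_def)
      then show ?thesis using RM_code_zero by simp
    qed
  next
    case (xor c d)
    have "(\<lambda>x. x \<in> RM_coords n \<and> c x \<noteq> d x) =
      (\<lambda>x. (x \<in> RM_coords n \<and> c x) \<noteq> (x \<in> RM_coords n \<and> d x))" by auto
    then show ?case using RM_code_xor[OF xor] by simp
  qed (simp add: RM_code_zero)
  then show ?thesis by (auto simp: punctured_code_def)
qed

subsection \<open>Rate\<close>

lemma RM_eval_eq_zero_iff:
  assumes "finite A" "A \<subseteq> Pow {..<m}"
  shows "RM_eval m A = (\<lambda>_. False) \<longleftrightarrow> A = {}"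
proof
  assume zero: "RM_eval m A = (\<lambda>_. False)"
  show "A = {}"
  proof (rule ccontr)
    assume "A \<noteq> {}"
    then obtain T where T: "T \<in> A" "\<forall>S\<in>A. S \<subseteq> T \<longrightarrow> T = S"
      using finite_has_minimal[OF assms(1)] by blast
    then have "{S\<in>A. S \<subseteq> T} = {T}" by auto
    then have "RM_eval m A T" using T(1) assms(2) by (auto simp: RM_eval_def)
    then show False using zero by simp
  qed
qed (simp add: RM_eval_empty)

lemma inj_on_RM_eval: "inj_on (RM_eval m) (Pow (RM_monomials v m))"
proof (rule inj_onI)
  fix A B assume AB: "A \<in> Pow (RM_monomials v m)" "B \<in> Pow (RM_monomials v m)"
    and eq: "RM_eval m A = RM_eval m B"
  have fin: "finite A" "finite B" using AB finite_RM_monomials finite_subset by blast+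
  have "RM_eval m (sym_diff A B) = (\<lambda>_. False)" using fin eq by (simp add: RM_eval_sym_diff)
  then have "sym_diff A B = {}"
    using fin AB by (subst (asm) RM_eval_eq_zero_iff) (auto simp: RM_monomials_def)
  then show "A = B" by auto
qed

lemma card_RM_monomials: "card (RM_monomials v m) = (\<Sum>k=0..v. m choose k)"
proof -
  have "RM_monomials v m = (\<Union>k\<in>{0..v}. {T. T \<subseteq> {..<m} \<and> card T = k})"
    by (auto simp: RM_monomials_def)
  also have "card \<dots> = (\<Sum>k=0..v. card {T. T \<subseteq> {..<m} \<and> card T = k})"
    by (intro card_UN_disjoint) (auto intro: finite_subset[of _ "Pow {..<m}"])
  finally show ?thesis by (simp add: n_subsets)
qed

lemma code_rate_RM_code: "code_rate (RM_coords m) (RM_code v m) = RM_rate v m"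
proof -
  have "card (RM_code v m) = 2 ^ (\<Sum>k=0..v. m choose k)"
    unfolding RM_code_eq
    by (simp add: card_image inj_on_RM_eval card_Pow finite_RM_monomials card_RM_monomials)
  then show ?thesis by (simp add: code_rate_def RM_rate_def card_RM_coords log_nat_power)
qed

subsection \<open>Double transitivity\<close>

definition transvection :: "('a set \<Rightarrow> bool) \<Rightarrow> 'a set \<Rightarrow> 'a set \<Rightarrow> 'a set" where
  "transvection l u x = (if l x then sym_diff x u else x)"

lemma RM_code_comp_transvection:
  assumes l: "l \<in> RM_code 1 m" and u: "u \<subseteq> {..<m}" and c: "c \<in> RM_code v m"
  shows "c \<circ> transvection l u \<in> RM_code v m"
proof (rule RM_code_comp_affine[OF _ _ c])
  show "transvection l u x \<subseteq> {..<m} \<longleftrightarrow> x \<subseteq> {..<m}" for x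
    using u by (auto simp: transvection_def)
  fix a assume "a < m"
  then have a: "RM_monomial m {a} \<in> RM_code 1 m" by (intro RM_code_monomial) auto
  have "RM_monomial m {a} (transvection l u x) = (RM_monomial m {a} x \<noteq> (a \<in> u \<and> l x))" for x
    using u RM_code_subset[OF l, of x]
    by (cases "l x") (auto simp: transvection_def RM_monomial_def)
  then have "RM_monomial m {a} \<circ> transvection l u =
      (if a \<in> u then (\<lambda>x. RM_monomial m {a} x \<noteq> l x) else RM_monomial m {a})"
    by (simp add: fun_eq_iff)
  then show "RM_monomial m {a} \<circ> transvection l u \<in> RM_code 1 m"
    using a RM_code_xor[OF a l] by simp
qed

lemma transvection_automorphism:
  assumes l: "l \<in> RM_code 1 m" and u: "u \<subseteq> {..<m}"
    and invariant: "\<And>x. x \<subseteq> {..<m} \<Longrightarrow> l (sym_diff x u) = l x"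
  shows "code_automorphism (RM_coords m) (RM_code v m) (transvection l u)"
proof -
  let ?\<phi> = "transvection l u"
  have outside: "?\<phi> x = x" if "x \<notin> RM_coords m" for x
    using that RM_code_subset[OF l] by (auto simp: transvection_def RM_coords_def)
  have involution: "?\<phi> (?\<phi> x) = x" for x
  proof (cases "l x")
    case True
    then have "l (sym_diff x u)" using invariant RM_code_subset[OF l] by blast
    then show ?thesis using True by (auto simp: transvection_def)
  qed (simp add: transvection_def)
  moreover have "?\<phi> ` RM_coords m \<subseteq> RM_coords m"
    using u by (auto simp: transvection_def RM_coords_def)
  ultimately have "bij_betw ?\<phi> (RM_coords m) (RM_coords m)"
    by (intro bij_betw_byWitness[where f' = ?\<phi>]) auto
  then have permutes: "?\<phi> permutes RM_coords m" using outside by (rule bij_imp_permutes)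
  have "c \<circ> ?\<phi> \<in> RM_code v m \<longleftrightarrow> c \<in> RM_code v m" for c
  proof -
    have "(c \<circ> ?\<phi>) \<circ> ?\<phi> = c" by (simp add: fun_eq_iff involution)
    then show ?thesis using RM_code_comp_transvection[OF l u] by metis
  qed
  with permutes show ?thesis by (simp add: code_automorphism_def)
qed

lemma RM_code_1_affine:
  assumes "l \<in> RM_code 1 m" "x \<subseteq> {..<m}" "y \<subseteq> {..<m}" "z \<subseteq> {..<m}"
  shows "l (sym_diff x (sym_diff y z)) = ((l x \<noteq> l y) \<noteq> l z)"
  using assms(1)
proof (induction rule: RM_code_induct)
  case (monomial T)
  then have "finite T" by (auto intro: finite_subset)
  then consider "T = {}" | a where "T = {a}"
    using monomial(2) by (metis One_nat_def card_0_eq card_1_singletonE le_Suc_eq le_zero_eq)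
  then show ?case using assms(2-4) by cases (auto simp: RM_monomial_def)
qed auto

lemma RM_code_1_separates:
  assumes "i \<subseteq> {..<m}" "j \<subseteq> {..<m}" "k \<subseteq> {..<m}" "j \<noteq> i" "k \<noteq> i"
  obtains l where "l \<in> RM_code 1 m" "\<not> l i" "l j" "l k"
proof -
  define \<delta> where "\<delta> = (\<lambda>a x. x \<subseteq> {..<m} \<and> (a \<in> x) \<noteq> (a \<in> i))"
  have \<delta>: "\<delta> a \<in> RM_code 1 m" if "a < m" for a
  proof -
    have "RM_monomial m {a} \<in> RM_code 1 m" "RM_monomial m {} \<in> RM_code 1 m"
      using that by (auto intro: RM_code_monomial)
    moreover have "\<delta> a = (if a \<in> i then (\<lambda>x. RM_monomial m {a} x \<noteq> RM_monomial m {} x)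
        else RM_monomial m {a})"
      by (auto simp: \<delta>_def RM_monomial_def fun_eq_iff)
    ultimately show ?thesis using RM_code_xor by simp
  qed
  obtain a b where "a \<in> sym_diff j i" "b \<in> sym_diff k i" using assms(4,5) by blast
  then have ab: "a < m" "b < m" "\<delta> a j" "\<delta> b k" "\<not> \<delta> a i" "\<not> \<delta> b i"
    using assms(1-3) by (auto simp: \<delta>_def)
  consider "\<delta> a k" | "\<delta> b j" | "\<not> \<delta> a k" "\<not> \<delta> b j" by blast
  then show thesis
  proof cases
    case 3
    then show thesis using ab that[OF RM_code_xor[OF \<delta>[of a] \<delta>[of b]]] by simp
  qed (use ab that \<delta> in blast)+
qed

lemma doubly_transitive_RM_code: "doubly_transitive_code (RM_coords m) (RM_code v m)"
  unfolding doubly_transitive_code_def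
proof (intro conjI ballI)
  fix i j assume "i \<in> RM_coords m" "j \<in> RM_coords m"
  then have ij: "i \<subseteq> {..<m}" "j \<subseteq> {..<m}" by (auto simp: RM_coords_def)
  have "code_automorphism (RM_coords m) (RM_code v m)
      (transvection (RM_monomial m {}) (sym_diff i j))"
    using ij by (intro transvection_automorphism RM_code_monomial) (auto simp: RM_monomial_def)
  moreover have "transvection (RM_monomial m {}) (sym_diff i j) i = j"
    using ij by (auto simp: transvection_def RM_monomial_def)
  ultimately show "\<exists>\<phi>. code_automorphism (RM_coords m) (RM_code v m) \<phi> \<and> \<phi> i = j" by blast
next
  fix i j k assume "i \<in> RM_coords m" "j \<in> RM_coords m - {i}" "k \<in> RM_coords m - {i}"
  then have ijk: "i \<subseteq> {..<m}" "j \<subseteq> {..<m}" "k \<subseteq> {..<m}" "j \<noteq> i" "k \<noteq> i"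
    by (auto simp: RM_coords_def)
  then obtain l where l: "l \<in> RM_code 1 m" "\<not> l i" "l j" "l k" by (rule RM_code_1_separates)
  have "code_automorphism (RM_coords m) (RM_code v m) (transvection l (sym_diff j k))"
    using ijk l by (intro transvection_automorphism) (auto simp: RM_code_1_affine)
  moreover have "transvection l (sym_diff j k) i = i" "transvection l (sym_diff j k) j = k"
    using l by (auto simp: transvection_def)
  ultimately show "\<exists>\<phi>. code_automorphism (RM_coords m) (RM_code v m) \<phi> \<and> \<phi> i = i \<and> \<phi> j = k"
    by blast
qed

section \<open>Rates of Reed--Muller codes\<close>

subsection \<open>The Gaussian tail function\<close>

interpretation std_normal: real_distribution std_normal_distribution
  by (rule real_dist_normal_dist)

lemma measure_density_lborel_singleton:
  fixes f :: "real \<Rightarrow> ennreal"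
  assumes "f \<in> borel_measurable borel"
  shows "measure (density lborel f) {x} = 0"
proof -
  have "absolutely_continuous lborel (density lborel f)"
    using assms by (intro absolutely_continuousI_density) simp
  moreover have "{x} \<in> null_sets lborel" by (simp add: null_sets_def)
  ultimately have "{x} \<in> null_sets (density lborel f)"
    unfolding absolutely_continuous_def by blast
  then show ?thesis by (simp add: null_sets_def measure_def)
qed

lemma isCont_cdf_std_normal: "isCont (cdf std_normal_distribution) x"
  by (simp add: std_normal.isCont_cdf measure_density_lborel_singleton)

lemma measure_std_normal_atLeast: "measure std_normal_distribution {t..} = Qfun t"
proof -
  have "set_integrable lborel {t..} std_normal_density"
    unfolding set_integrable_def by (rule integrable_mult_indicator) auto
  then have "(LINT x:{t..}|lborel. std_normal_density x) = integral {t..} std_normal_density"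
    by (rule set_borel_integral_eq_integral)
  also have "\<dots> = integral {t..} (\<lambda>x. 1 / sqrt (2 * pi) * exp (-(x^2) / 2))"
    by (intro Henstock_Kurzweil_Integration.integral_cong) (simp add: std_normal_density_def)
  also have "\<dots> = Qfun t"
    unfolding Qfun_def by (subst integral_mult_right) simp
  also have "(LINT x:{t..}|lborel. std_normal_density x) =
      integral\<^sup>L std_normal_distribution (indicator {t..})"
    unfolding set_lebesgue_integral_def
    by (subst integral_density) (auto intro!: Bochner_Integration.integral_cong)
  finally show ?thesis by simp
qed

lemma Qfun_eq_cdf: "Qfun t = 1 - cdf std_normal_distribution t"
proof -
  have "cdf std_normal_distribution t = measure std_normal_distribution {..<t}"
    using std_normal.finite_measure_Union[of "{..<t}" "{t}"]
    unfolding ivl_disj_un(2) by (simp add: cdf_def measure_density_lborel_singleton)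
  also have "\<dots> = 1 - measure std_normal_distribution {t..}"
    using std_normal.prob_compl[of "{t..}"] by (simp add: Compl_eq_Diff_UNIV[symmetric] not_le)
  finally show ?thesis by (simp add: measure_std_normal_atLeast)
qed

lemma strict_mono_cdf_std_normal: "strict_mono (cdf std_normal_distribution)"
proof (rule strict_monoI, rule ccontr)
  fix s t :: real
  assume "s < t" and "\<not> cdf std_normal_distribution s < cdf std_normal_distribution t"
  then have "measure std_normal_distribution {s<..t} = 0"
    using std_normal.cdf_diff_eq[of s t] std_normal.cdf_nondecreasing[of s t] by simp
  then have "{s<..t} \<in> null_sets std_normal_distribution"
    by (auto simp: null_sets_def std_normal.emeasure_eq_measure)
  then have "AE x in lborel. x \<notin> {s<..t}"
    by (subst (asm) null_sets_density_iff)
       (auto elim!: eventually_mono simp: std_normal_density_def)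
  then have "{s<..t} \<in> null_sets lborel" by (simp add: AE_iff_null_sets)
  then show False using \<open>s < t\<close> by (auto simp: null_sets_def)
qed

lemma Qfun_Qinv:
  assumes "0 < y" "y < 1"
  shows "Qfun (Qinv y) = y"
proof -
  let ?F = "cdf std_normal_distribution"
  have "\<forall>\<^sub>F x in at_bot. ?F x < 1 - y" "\<forall>\<^sub>F x in at_top. ?F x > 1 - y"
    using assms by (auto intro: order_tendstoD[OF std_normal.cdf_lim_at_bot]
        order_tendstoD[OF std_normal.cdf_lim_at_top_prob])
  then obtain a b where ab: "?F a < 1 - y" "?F b > 1 - y"
    by (metis eventually_happens' trivial_limit_at_bot_linorder trivial_limit_at_top_linorder)
  then have "a \<le> b" using std_normal.cdf_nondecreasing[of b a] by linarith
  then obtain x where "?F x = 1 - y"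
    using IVT[of ?F a "1 - y" b] ab isCont_cdf_std_normal by (auto simp: less_imp_le)
  moreover from this have "z = x" if "Qfun z = y" for z
    using that strict_mono_eq[OF strict_mono_cdf_std_normal, of z x] by (simp add: Qfun_eq_cdf)
  ultimately have "\<exists>!x. Qfun x = y" by (intro ex1I[of _ x]) (auto simp: Qfun_eq_cdf)
  then show ?thesis unfolding Qinv_def by (rule theI')
qed

subsection \<open>The central limit theorem for symmetric binomial distributions\<close>

definition standardized_binomial :: "nat \<Rightarrow> real measure" where
  "standardized_binomial m =
     distr (measure_pmf (binomial_pmf m (1/2))) borel (\<lambda>k. (2 * real k - real m) / sqrt (real m))"

lemma char_distr_binomial_pmf:
  assumes "p \<in> {0..1}"
  shows "char (distr (measure_pmf (binomial_pmf n p)) borel (\<lambda>k. a * real k + b)) t =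
    iexp (t * b) * (of_real p * iexp (t * a) + of_real (1 - p)) ^ n"
proof -
  have "char (distr (measure_pmf (binomial_pmf n p)) borel (\<lambda>k. a * real k + b)) t =
      (CLINT k|binomial_pmf n p. iexp (t * (a * real k + b)))"
    unfolding char_def by (subst integral_distr) auto
  also have "\<dots> = (\<Sum>k\<le>n. (real (n choose k) * p ^ k * (1 - p) ^ (n - k)) *\<^sub>R
      iexp (t * (a * real k + b)))"
    using assms by (rule expectation_binomial_pmf')
  also have "\<dots> = (\<Sum>k\<le>n. iexp (t * b) *
      (of_nat (n choose k) * (of_real p * iexp (t * a)) ^ k * of_real (1 - p) ^ (n - k)))"
  proof (intro sum.cong refl)
    fix k
    have "iexp (t * (a * real k + b)) = iexp (t * b) * iexp (t * a) ^ k"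
      unfolding exp_of_nat_mult[symmetric] exp_add[symmetric] by (simp add: algebra_simps)
    then show "(real (n choose k) * p ^ k * (1 - p) ^ (n - k)) *\<^sub>R iexp (t * (a * real k + b)) =
        iexp (t * b) *
          (of_nat (n choose k) * (of_real p * iexp (t * a)) ^ k * of_real (1 - p) ^ (n - k))"
      by (simp add: scaleR_conv_of_real power_mult_distrib)
  qed
  also have "\<dots> = iexp (t * b) * (of_real p * iexp (t * a) + of_real (1 - p)) ^ n"
    by (simp only: sum_distrib_left binomial_ring)
  finally show ?thesis .
qed

lemma char_standardized_binomial:
  "char (standardized_binomial m) t = complex_of_real (cos (t / sqrt (real m)) ^ m)"
proof -
  let ?\<theta> = "t / sqrt (real m)"
  have affine: "(\<lambda>k. (2 * real k - real m) / sqrt (real m)) =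
      (\<lambda>k. 2 / sqrt (real m) * real k + - sqrt (real m))"
    by (auto simp: fun_eq_iff diff_divide_distrib real_div_sqrt)
  have "char (standardized_binomial m) t =
      iexp (t * - sqrt (real m)) *
        (of_real (1/2) * iexp (t * (2 / sqrt (real m))) + of_real (1 - 1/2)) ^ m"
    unfolding standardized_binomial_def affine by (rule char_distr_binomial_pmf) simp
  also have "t * - sqrt (real m) = real m * - ?\<theta>"
    using arg_cong[OF real_div_sqrt[of "real m"], of "\<lambda>s. t * s"] by (simp add: mult.commute)
  also have "iexp (real m * - ?\<theta>) = iexp (- ?\<theta>) ^ m"
    by (simp only: exp_of_nat_mult[symmetric] of_real_mult of_real_of_nat_eq mult.left_commute)
  also have "\<dots> * (of_real (1/2) * iexp (t * (2 / sqrt (real m))) + of_real (1 - 1/2)) ^ m =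
      (iexp (- ?\<theta>) * (of_real (1/2) * iexp (2 * ?\<theta>) + of_real (1 - 1/2))) ^ m"
    by (simp add: power_mult_distrib mult.commute)
  also have "iexp (- ?\<theta>) * (of_real (1/2) * iexp (2 * ?\<theta>) + of_real (1 - 1/2)) =
      (iexp ?\<theta> + iexp (- ?\<theta>)) / 2"
    by (simp add: algebra_simps exp_add[symmetric])
  also have "\<dots> = complex_of_real (cos ?\<theta>)"
    by (simp add: complex_eq_iff Re_exp Im_exp)
  finally show ?thesis by simp
qed

lemma weak_conv_standardized_binomial: "weak_conv_m standardized_binomial std_normal_distribution"
proof (intro levy_continuity)
  show "real_distribution (standardized_binomial m)" for m
    unfolding standardized_binomial_def
    by (intro prob_space.real_distribution_distr measure_pmf.prob_space_axioms) simp
  show "real_distribution std_normal_distribution" by (rule real_dist_normal_dist)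
  fix t :: real
  have "(\<lambda>m. cos (t / sqrt (real m)) ^ m) \<longlonglongrightarrow> exp (- (t * t / 2))" by real_asymp
  from tendsto_of_real[OF this, where 'a = complex]
  show "(\<lambda>m. char (standardized_binomial m) t) \<longlonglongrightarrow> char std_normal_distribution t"
    by (simp add: char_standardized_binomial char_std_normal_distribution power2_eq_square)
qed

lemma RM_rate_eq_binomial: "RM_rate v m = measure (binomial_pmf m (1/2)) {..v}"
proof -
  have "pmf (binomial_pmf m (1/2)) k = real (m choose k) / 2 ^ m" for k
  proof (cases "k \<le> m")
    case True
    then have "(1/2::real) ^ k * (1/2) ^ (m - k) = 1 / 2 ^ m"
      by (metis le_add_diff_inverse power_add power_one_over)
    then show ?thesis by (simp add: mult.assoc)
  qed (simp add: binomial_eq_0)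
  then show ?thesis
    by (simp add: measure_measure_pmf_finite RM_rate_def sum_divide_distrib atLeast0AtMost)
qed

lemma cdf_standardized_binomial:
  assumes "m > 0" "0 \<le> real m / 2 + sqrt (real m) / 2 * t"
  shows "cdf (standardized_binomial m) t = RM_rate (nat \<lfloor>real m / 2 + sqrt (real m) / 2 * t\<rfloor>) m"
proof -
  let ?v = "nat \<lfloor>real m / 2 + sqrt (real m) / 2 * t\<rfloor>"
  have "(2 * real k - real m) / sqrt (real m) \<le> t \<longleftrightarrow> k \<le> ?v" for k
  proof -
    have "(2 * real k - real m) / sqrt (real m) \<le> t \<longleftrightarrow> real k \<le> real m / 2 + sqrt (real m) / 2 * t"
      using assms(1) by (simp add: field_simps)
    also have "\<dots> \<longleftrightarrow> k \<le> ?v" using assms(2) by (simp add: le_nat_iff le_floor_iff)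
    finally show ?thesis .
  qed
  then show ?thesis
    unfolding cdf_def standardized_binomial_def RM_rate_eq_binomial
    by (subst measure_distr) (auto simp: vimage_def atMost_def)
qed

lemma RM_rate_tendsto_cdf_std_normal:
  "(\<lambda>m. RM_rate (nat (max \<lfloor>real m / 2 + sqrt (real m) / 2 * t\<rfloor> 0)) m)
     \<longlonglongrightarrow> cdf std_normal_distribution t"
proof (rule Lim_transform_eventually)
  show "(\<lambda>m. cdf (standardized_binomial m) t) \<longlonglongrightarrow> cdf std_normal_distribution t"
    using weak_conv_standardized_binomial isCont_cdf_std_normal
    by (simp add: weak_conv_m_def weak_conv_def)
  have "filterlim (\<lambda>m. real m / 2 + sqrt (real m) / 2 * t) at_top sequentially" by real_asymp
  then have "\<forall>\<^sub>F m in sequentially. 0 \<le> real m / 2 + sqrt (real m) / 2 * t"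
    by (simp add: filterlim_at_top)
  then show "\<forall>\<^sub>F m in sequentially. cdf (standardized_binomial m) t =
      RM_rate (nat (max \<lfloor>real m / 2 + sqrt (real m) / 2 * t\<rfloor> 0)) m"
    using eventually_gt_at_top[of 0]
    by eventually_elim (simp add: cdf_standardized_binomial max_def)
qed

subsection \<open>Rates for a fixed degree\<close>

lemma central_binomial_Suc:
  "real (2 * Suc n choose Suc n) / 4 ^ Suc n =
     real (2 * n choose n) / 4 ^ n * ((2 * real n + 1) / (2 * real n + 2))"
proof -
  define b b' where "b = real (2 * n choose n)" and "b' = real (2 * Suc n choose Suc n)"
  have "Suc n * (Suc (2 * n) choose Suc n) = Suc (2 * n) * (2 * n choose n)"
    by (rule Suc_times_binomial)
  moreover have "2 * Suc n choose Suc n = 2 * (Suc (2 * n) choose Suc n)"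
    using central_binomial_odd[of "Suc (2 * n)"] by simp
  ultimately have "Suc n * (2 * Suc n choose Suc n) = 2 * Suc (2 * n) * (2 * n choose n)"
    by (simp only: mult.assoc mult.left_commute[of "Suc n" 2])
  then have "real (Suc n) * b' = 2 * real (Suc (2 * n)) * b"
    unfolding b_def b'_def by (metis of_nat_mult of_nat_numeral)
  then have "b' / (4 * 4 ^ n) = b / 4 ^ n * ((2 * real n + 1) / (2 * real n + 2))"
    by (simp add: divide_simps) (simp add: algebra_simps)
  then show ?thesis by (simp only: b_def b'_def power_Suc)
qed

lemma central_binomial_upper_bound: "real (2 * n choose n) / 4 ^ n \<le> 1 / sqrt (2 * real n + 1)"
proof (induction n)
  case (Suc n)
  have "((2 * real n + 1) / (2 * real n + 2))\<^sup>2 \<le> (2 * real n + 1) / (2 * real n + 3)"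
    by (simp add: power_divide divide_le_eq le_divide_eq)
       (simp add: power2_eq_square algebra_simps)
  then have "(2 * real n + 1) / (2 * real n + 2) \<le> sqrt (2 * real n + 1) / sqrt (2 * real n + 3)"
    unfolding real_sqrt_divide[symmetric] by (rule real_le_rsqrt)
  then have "real (2 * n choose n) / 4 ^ n * ((2 * real n + 1) / (2 * real n + 2)) \<le>
      1 / sqrt (2 * real n + 1) * (sqrt (2 * real n + 1) / sqrt (2 * real n + 3))"
    using Suc.IH by (intro mult_mono) auto
  also have "\<dots> = 1 / sqrt (2 * real (Suc n) + 1)" by simp
  finally show ?case unfolding central_binomial_Suc .
qed simp

lemma binomial_upper_bound: "real (n choose k) / 2 ^ n \<le> 1 / sqrt (real n + 1)"
proof -
  have "real (n choose k) / 2 ^ n \<le> real (n choose (n div 2)) / 2 ^ n"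
    by (intro divide_right_mono) (auto intro: binomial_maximum)
  also have "\<dots> \<le> 1 / sqrt (real n + 1)"
  proof (cases "even n")
    case True
    then obtain l where "n = 2 * l" by auto
    then show ?thesis using central_binomial_upper_bound[of l] by (simp add: power_mult)
  next
    case False
    then obtain l where l: "n = Suc (2 * l)" by (auto elim: oddE)
    have "2 * Suc l choose Suc l = 2 * (n choose l)"
      using central_binomial_odd[of n] by (simp add: l)
    then have "real (n choose (n div 2)) / 2 ^ n = real (2 * Suc l choose Suc l) / 4 ^ Suc l"
      by (simp add: l power_mult)
    also have "\<dots> \<le> 1 / sqrt (2 * real (Suc l) + 1)" by (rule central_binomial_upper_bound)
    also have "\<dots> \<le> 1 / sqrt (real n + 1)" by (intro divide_left_mono) (auto simp: l)
    finally show ?thesis .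
  qed
  finally show ?thesis .
qed

lemma RM_rate_Suc: "RM_rate v (Suc m) = RM_rate v m - real (m choose v) / 2 ^ Suc m"
proof -
  have "(\<Sum>k=0..v. real (Suc m choose k)) = 2 * (\<Sum>k=0..v. real (m choose k)) - real (m choose v)"
    by (induction v) (auto simp: algebra_simps)
  then show ?thesis by (simp add: RM_rate_def field_simps)
qed

lemma RM_rate_diff_le: "RM_rate v n - RM_rate v (n + j) \<le> real j / sqrt (real n + 1)"
proof (induction j)
  case (Suc j)
  have "RM_rate v (n + j) - RM_rate v (n + Suc j) = real (n + j choose v) / 2 ^ (n + j) / 2"
    by (simp add: RM_rate_Suc)
  also have "\<dots> \<le> real (n + j choose v) / 2 ^ (n + j)" by (simp add: field_simps)
  also have "\<dots> \<le> 1 / sqrt (real (n + j) + 1)" by (rule binomial_upper_bound)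
  also have "\<dots> \<le> 1 / sqrt (real n + 1)" by (intro divide_left_mono) auto
  finally show ?case using Suc by (simp add: add_divide_distrib)
qed simp

section \<open>Achieving capacity\<close>

lemma RM_exit_sharp_threshold:
  assumes "n \<le> m" "p \<in> {0..1}"
  shows "exit_function (RM_coords m) (RM_code v m) {} p * (1 - p - RM_rate v m) \<le>
    RM_rate v n - RM_rate v m + 2 ^ n / 2 ^ m"
proof -
  have "RM_coords n \<subseteq> RM_coords m" "{} \<in> RM_coords n" using assms(1) by (auto simp: RM_coords_def)
  then show ?thesis
    using exit_function_sharp_threshold[OF linear_RM_code doubly_transitive_RM_code
        linear_RM_code doubly_transitive_RM_code _ punctured_RM_code_subset[OF assms(1)] _ assms(2)]
    by (simp add: code_rate_RM_code card_RM_coords)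
qed

lemma RM_bit_MAP_Pb_le:
  assumes "j \<le> m" "p \<in> {0..1}" "RM_rate v m < 1 - p"
  shows "bit_MAP_Pb (RM_coords m) (RM_code v m) p \<le>
    (real j / sqrt (real m - real j + 1) + (1/2) ^ j) / (1 - p - RM_rate v m)"
proof -
  let ?h = "exit_function (RM_coords m) (RM_code v m) {} p"
  have "?h * (1 - p - RM_rate v m) \<le> RM_rate v (m - j) - RM_rate v m + 2 ^ (m - j) / 2 ^ m"
    using assms by (intro RM_exit_sharp_threshold) auto
  also have "2 ^ (m - j) / 2 ^ m = (1/2 :: real) ^ j"
    using assms(1) by (simp add: power_diff power_divide)
  also have "RM_rate v (m - j) - RM_rate v m \<le> real j / sqrt (real m - real j + 1)"
    using RM_rate_diff_le[of v "m - j" j] assms(1) by (simp add: of_nat_diff)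
  finally have "?h \<le> (real j / sqrt (real m - real j + 1) + (1/2) ^ j) / (1 - p - RM_rate v m)"
    using assms(3) by (simp add: pos_le_divide_eq)
  moreover have "bit_MAP_Pb (RM_coords m) (RM_code v m) p \<le> ?h"
    using assms(2) linear_RM_code doubly_transitive_RM_code
    by (intro bit_MAP_Pb_le_exit_function) (auto simp: RM_coords_def)
  ultimately show ?thesis by linarith
qed

lemma RM_bit_MAP_Pb_tendsto_0:
  assumes rate: "(\<lambda>m. RM_rate (v m) m) \<longlonglongrightarrow> r" and p: "p \<in> {0..1}" "p < 1 - r"
  shows "(\<lambda>m. bit_MAP_Pb (RM_coords m) (RM_code (v m) m) p) \<longlonglongrightarrow> 0"
proof (rule tendsto_sandwich[where f = "\<lambda>_. 0"])
  \<comment> \<open>any \<open>j \<rightarrow> \<infinity>\<close> with \<open>j = o(\<surd>m)\<close> would do\<close>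
  define j where "j m = nat \<lfloor>real m powr (1/4)\<rfloor>" for m :: nat
  define \<delta> where "\<delta> m = real (j m) / sqrt (real m - real (j m) + 1) + (1/2) ^ j m" for m
  have "\<delta> \<longlonglongrightarrow> 0" unfolding \<delta>_def j_def by real_asymp
  then have "(\<lambda>m. \<delta> m / (1 - p - RM_rate (v m) m)) \<longlonglongrightarrow> 0 / (1 - p - r)"
    using p(2) by (intro tendsto_intros rate) auto
  then show "(\<lambda>m. \<delta> m / (1 - p - RM_rate (v m) m)) \<longlonglongrightarrow> 0" by simp
  have "\<forall>\<^sub>F m in sequentially. real (j m) < real m" unfolding j_def by real_asymp
  moreover have "\<forall>\<^sub>F m in sequentially. RM_rate (v m) m < 1 - p"
    using rate p(2) by (intro order_tendstoD(2)) auto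
  ultimately show "\<forall>\<^sub>F m in sequentially.
      bit_MAP_Pb (RM_coords m) (RM_code (v m) m) p \<le> \<delta> m / (1 - p - RM_rate (v m) m)"
    unfolding \<delta>_def by eventually_elim (rule RM_bit_MAP_Pb_le, use p in auto)
  show "\<forall>\<^sub>F m in sequentially. 0 \<le> bit_MAP_Pb (RM_coords m) (RM_code (v m) m) p"
    using p(1) by (intro always_eventually allI bit_MAP_Pb_nonneg) auto
qed simp

theorem theorem6:
  fixes r :: real and v :: "nat \<Rightarrow> nat"
  assumes "0 < r" "r < 1"
    and "\<And>m. v m = nat (max \<lfloor>real m / 2 + sqrt (real m) / 2 * Qinv (1 - r)\<rfloor> 0)"
  shows "(\<lambda>m. RM_rate (v m) m) \<longlonglongrightarrow> r \<and>
         capacity_achieving_BEC (\<lambda>m. RM_rate (v m) m)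
           (\<lambda>m p. bit_MAP_Pb (RM_coords m) (RM_code (v m) m) p) r"
proof -
  have "cdf std_normal_distribution (Qinv (1 - r)) = r"
    using Qfun_Qinv[of "1 - r"] assms(1,2) by (simp add: Qfun_eq_cdf)
  then have rate: "(\<lambda>m. RM_rate (v m) m) \<longlonglongrightarrow> r"
    using RM_rate_tendsto_cdf_std_normal[of "Qinv (1 - r)"] by (simp add: assms(3))
  moreover have "(\<lambda>m. bit_MAP_Pb (RM_coords m) (RM_code (v m) m) p) \<longlonglongrightarrow> 0"
    if "0 \<le> p" "p < 1 - r" for p
    using assms(1) that by (intro RM_bit_MAP_Pb_tendsto_0[OF rate]) auto
  ultimately show ?thesis by (simp add: capacity_achieving_BEC_def)
qed

end
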